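(* Let $n\ge 2$ and let $\alpha_1,\dots,\alpha_n$ be pairwise distinct complex numbers. Let $f(x)=\prod_{m=1}^n(x-\alpha_m)$, and let $T$ be the $n\times n$ matrix with entries $T_{ij}=\frac{\partial}{\partial\alpha_j}f'(\alpha_i)$. For each $k\in\{1,\dots,n\}$, let $D_k$ be the determinant of the $(n-1)\times(n-1)$ matrix obtained from $T$ by deleting the $k$-th row and the $k$-th column, and let $f_k(x)=f(x)/(x-\alpha_k)$. Then for each $k\in\{1,\dots,n\}$, $$D_k=(-1)^{\binom{n-1}{2}}\,(n-1)!\,\Delta(f_k)=(-1)^{\binom{n-1}{2}}\,(n-1)!\prod_{\substack{1\le i<j\le n\\ i\ne k,\ j\ne k}}(\alpha_i-\alpha_j)^2 .$$
   Context: Here $f'(\alpha_i)=\prod_{m\ne i}(\alpha_i-\alpha_m)$ is regarded as a polynomial function of the variables $(\alpha_1,\dots,\alpha_n)$, and $T$ is the Jacobian matrix of the map $(\alpha_1,\dots,\alpha_n)\mapsto(f'(\alpha_1),\dots,f'(\alpha_n))$. Explicitly, for $i\ne j$, $$T_{ij}=-\prod_{m\ne i,\,j}(\alpha_i-\alpha_m),$$ and $$T_{ii}=\sum_{j\ne i}\ \prod_{m\ne i,\,j}(\alpha_i-\alpha_m),$$ with empty products equal to $1$. For a monic polynomial $g$ with roots $\beta_1,\dots,\beta_r$ (listed with multiplicity), $\Delta(g)=\prod_{1\le i<j\le r}(\beta_i-\beta_j)^2$ denotes its discriminant (equal to $1$ if $r=1$). The binomial coefficient $\binom{1}{2}$ is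 $0$. *)

theory Defs
  imports
    "HOL-Analysis.Derivative"
    "Jordan_Normal_Form.Determinant"
begin

text \<open>
  The parameters \<open>\<alpha>\<^sub>1, \<dots>, \<alpha>\<^sub>n\<close> are given by a function \<open>a\<close> on \<open>nat\<close>, of which only the values
  \<open>a 0, \<dots>, a (n - 1)\<close> matter: indices run over \<open>{..<n}\<close>, as do matrix indices.
\<close>

definition root_poly :: "nat \<Rightarrow> (nat \<Rightarrow> complex) \<Rightarrow> complex poly" where
  "root_poly n a = (\<Prod>m<n. [:- a m, 1:])"

text \<open>
  The \<open>i\<close>-th component of the map \<open>(\<alpha>\<^sub>1, \<dots>, \<alpha>\<^sub>n) \<mapsto> (f'(\<alpha>\<^sub>1), \<dots>, f'(\<alpha>\<^sub>n))\<close>. Both \<open>f'\<close> and its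
  argument depend on \<open>a\<close>.
\<close>

definition deriv_at_root :: "nat \<Rightarrow> nat \<Rightarrow> (nat \<Rightarrow> complex) \<Rightarrow> complex" where
  "deriv_at_root n i a = poly (pderiv (root_poly n a)) (a i)"

definition partial_deriv :: "nat \<Rightarrow> ((nat \<Rightarrow> complex) \<Rightarrow> complex) \<Rightarrow> (nat \<Rightarrow> complex) \<Rightarrow> complex" where
  "partial_deriv j F a = deriv (\<lambda>x. F (a(j := x))) (a j)"

definition jacobian_mat :: "nat \<Rightarrow> (nat \<Rightarrow> complex) \<Rightarrow> complex mat" where
  "jacobian_mat n a = mat n n (\<lambda>(i, j). partial_deriv j (deriv_at_root n i) a)"

definition sq_diff_prod :: "complex list \<Rightarrow> complex" where
  "sq_diff_prod bs = (\<Prod>j<length bs. \<Prod>i<j. (bs ! i - bs ! j)\<^sup>2)"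

text \<open>
  The discriminant of a monic polynomial. The order in which the roots are listed is irrelevant,
  see \<open>discriminant_eq\<close> below.
\<close>

definition discriminant :: "complex poly \<Rightarrow> complex" where
  "discriminant g = sq_diff_prod (SOME bs. mset bs = proots g)"

lemma sq_diff_prod_Cons:
  "sq_diff_prod (b # bs) = (\<Prod>c\<in>#mset bs. (b - c)\<^sup>2) * sq_diff_prod bs"
proof -
  have *: "(\<Prod>c\<in>#mset bs. (b - c)\<^sup>2) = (\<Prod>j<length bs. (b - bs ! j)\<^sup>2)"
    by (subst mset_map[symmetric], subst prod_mset_prod_list)
       (simp add: prod.list_conv_set_nth atLeast0LessThan)
  have "sq_diff_prod (b # bs)
      = (\<Prod>j<length bs. \<Prod>i<Suc j. ((b # bs) ! i - bs ! j)\<^sup>2)"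
    by (simp add: sq_diff_prod_def prod.lessThan_Suc_shift del: prod.lessThan_Suc)
  also have "\<dots> = (\<Prod>j<length bs. (b - bs ! j)\<^sup>2 * (\<Prod>i<j. (bs ! i - bs ! j)\<^sup>2))"
    by (simp add: prod.lessThan_Suc_shift del: prod.lessThan_Suc)
  finally show ?thesis
    by (simp add: * sq_diff_prod_def prod.distrib)
qed

lemma sq_diff_prod_middle:
  "sq_diff_prod (us @ b # vs) = sq_diff_prod (b # us @ vs)"
proof (induction us)
  case (Cons u us)
  have "(u - b)\<^sup>2 = (b - u)\<^sup>2"
    by (rule power2_commute)
  with Cons show ?case
    by (simp add: sq_diff_prod_Cons mult_ac)
qed simp

lemma sq_diff_prod_mset_cong:
  "mset bs = mset cs \<Longrightarrow> sq_diff_prod bs = sq_diff_prod cs"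
proof (induction bs arbitrary: cs)
  case (Cons b bs)
  then have "b \<in> set cs"
    by (metis list.set_intros(1) mset_eq_setD)
  then obtain us vs where cs: "cs = us @ b # vs"
    by (auto dest: split_list)
  with Cons.prems have "mset bs = mset (us @ vs)"
    by simp
  with Cons.IH[OF this] show ?case
    by (simp add: cs sq_diff_prod_middle sq_diff_prod_Cons)
qed simp

lemma discriminant_eq:
  assumes "mset bs = proots g"
  shows "discriminant g = sq_diff_prod bs"
proof -
  have "mset (SOME bs. mset bs = proots g) = proots g"
    using assms by (rule someI)
  with assms show ?thesis
    unfolding discriminant_def by (intro sq_diff_prod_mset_cong) simp
qed

lemma deriv_at_root_eq:
  assumes "i < n"
  shows "deriv_at_root n i a = (\<Prod>m\<in>{..<n} - {i}. a i - a m)"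
proof -
  have "deriv_at_root n i a = (\<Sum>j<n. \<Prod>m\<in>{..<n} - {j}. a i - a m)"
    by (simp add: deriv_at_root_def root_poly_def pderiv_prod pderiv_pCons poly_sum poly_prod)
  also have "\<dots> = (\<Sum>j<n. if j = i then \<Prod>m\<in>{..<n} - {i}. a i - a m else 0)"
    using assms by (intro sum.cong) (auto intro!: prod_zero)
  finally show ?thesis
    using assms by simp
qed

lemma deriv_at_root_has_partial_deriv:
  assumes "i < n" "j < n"
  shows "((\<lambda>x. deriv_at_root n i (a(j := x))) has_field_derivative
      (if i = j then \<Sum>l\<in>{..<n} - {i}. \<Prod>m\<in>{..<n} - {i, l}. a i - a m
       else - (\<Prod>m\<in>{..<n} - {i, j}. a i - a m))) (at (a j))"
proof (cases "i = j")
  case True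
  have eq: "(\<lambda>x. deriv_at_root n i (a(j := x))) = (\<lambda>x. \<Prod>m\<in>{..<n} - {i}. x - a m)"
    using assms True by (auto simp: deriv_at_root_eq fun_eq_iff intro!: prod.cong)
  have "((\<lambda>x. \<Prod>m\<in>{..<n} - {i}. x - a m) has_field_derivative
      (\<Sum>l\<in>{..<n} - {i}. 1 * (\<Prod>m\<in>{..<n} - {i} - {l}. a j - a m))) (at (a j))"
    by (rule has_field_derivative_prod) (auto intro!: derivative_eq_intros)
  moreover have "{..<n} - {i} - {l} = {..<n} - {i, l}" for l
    by auto
  ultimately show ?thesis
    using eq by (simp add: True)
next
  case False
  have "{..<n} - {i} = insert j ({..<n} - {i, j})"
    using assms False by auto
  then have "deriv_at_root n i (a(j := x)) = (a i - x) * (\<Prod>m\<in>{..<n} - {i, j}. a i - a m)" for x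
    using assms False by (auto simp: deriv_at_root_eq intro!: prod.cong)
  then show ?thesis
    using False by (auto intro!: derivative_eq_intros)
qed

lemma jacobian_mat_index:
  assumes "i < n" "j < n"
  shows "jacobian_mat n a $$ (i, j) =
      (if i = j then \<Sum>l\<in>{..<n} - {i}. \<Prod>m\<in>{..<n} - {i, l}. a i - a m
       else - (\<Prod>m\<in>{..<n} - {i, j}. a i - a m))"
  using assms DERIV_imp_deriv[OF deriv_at_root_has_partial_deriv[OF assms]]
  by (simp add: jacobian_mat_def partial_deriv_def)

end

theory Submission
  imports Defs
begin

text \<open>
  Write \<open>m = n - 1\<close>. The \<open>i\<close>-th row of the Jacobian matrix is \<open>f'(\<alpha>\<^sub>i)\<close> times the row with entries
  \<open>-1 / (\<alpha>\<^sub>i - \<alpha>\<^sub>j)\<close> off the diagonal and \<open>\<Sum>\<^sub>l 1 / (\<alpha>\<^sub>i - \<alpha>\<^sub>l)\<close> on it. Only differences of the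
  \<open>\<alpha>\<^sub>i\<close> occur, so \<open>\<alpha>\<^sub>k\<close> may be moved to \<open>0\<close>; let \<open>y\<^sub>1, \<dots>, y\<^sub>m\<close> be the other points after this
  translation. They are distinct and nonzero.

  The rescaled matrix, applied to the vector of values of a polynomial \<open>p\<close>, sums the divided
  differences \<open>(p(\<alpha>\<^sub>i) - p(\<alpha>\<^sub>l)) / (\<alpha>\<^sub>i - \<alpha>\<^sub>l)\<close> over \<open>l \<noteq> i\<close>. Deleting row and column \<open>k\<close> means
  restricting to polynomials that vanish at \<open>\<alpha>\<^sub>k = 0\<close> and forgetting the value of the result there.
  This operator maps \<open>x\<^sup>r\<^sup>+\<^sup>1\<close> to \<open>(m - r) x\<^sup>r\<close> plus terms of lower degree
  (\<open>divdiff_mat_apply_power\<close>). Hence, with \<open>N\<close> the minor of the rescaled matrix, \<open>D\<close> the diagonal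
  matrix of the \<open>y\<^sub>i\<close> and \<open>V\<close> the Vandermonde matrix of the \<open>y\<^sub>i\<close>, one has \<open>N D V = V U\<close> with \<open>U\<close>
  upper triangular and diagonal entries \<open>m, m - 1, \<dots>, 1\<close>. As \<open>det V \<noteq> 0\<close>, it cancels, and
  \<open>det N \<cdot> \<Prod>\<^sub>i y\<^sub>i = m!\<close> (\<open>det_divdiff_mat\<close>).

  The row factors multiply to \<open>\<Prod>\<^sub>i y\<^sub>i\<close> times \<open>\<Prod>\<^sub>i \<Prod>\<^sub>l\<^sub>\<noteq>\<^sub>i (y\<^sub>i - y\<^sub>l)\<close>. The first factor turns \<open>det N\<close>
  into \<open>m!\<close>; the second is the discriminant of \<open>f\<^sub>k\<close> up to the sign \<open>(-1)\<close> to the number of pairs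
  (\<open>prod_diff_eq_sq_diff_prod\<close>).
\<close>

section \<open>Vandermonde matrices\<close>

definition vandermonde_mat :: "nat \<Rightarrow> (nat \<Rightarrow> 'a::comm_ring_1) \<Rightarrow> 'a mat" where
  "vandermonde_mat m y = mat m m (\<lambda>(i, r). y i ^ r)"

text \<open>
  A vector in the kernel lists the coefficients of a polynomial of degree less than \<open>m\<close> with the
  \<open>m\<close> roots \<open>y 0, \<dots>, y (m - 1)\<close>.
\<close>

lemma det_vandermonde_mat_nonzero:
  fixes y :: "nat \<Rightarrow> 'a::field"
  assumes inj: "inj_on y {..<m}"
  shows "det (vandermonde_mat m y) \<noteq> 0"
proof
  let ?V = "vandermonde_mat m y"
  have V: "?V \<in> carrier_mat m m"
    by (simp add: vandermonde_mat_def)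
  assume "det ?V = 0"
  then obtain v where v: "v \<in> carrier_vec m" "v \<noteq> 0\<^sub>v m" "?V *\<^sub>v v = 0\<^sub>v m"
    using det_0_iff_vec_prod_zero_field[OF V] by blast
  define p where "p = (\<Sum>r<m. monom (v $ r) r)"
  have coeff_p: "coeff p r = (if r < m then v $ r else 0)" for r
    by (auto simp: p_def coeff_sum)
  have root: "poly p (y i) = 0" if "i < m" for i
  proof -
    have "poly p (y i) = (?V *\<^sub>v v) $ i"
      using that v(1) V
      by (simp add: p_def poly_sum poly_monom scalar_prod_def vandermonde_mat_def
          atLeast0LessThan mult.commute)
    also have "\<dots> = 0"
      using that v(3) by simp
    finally show ?thesis .
  qed
  have "p = 0"
  proof (rule ccontr)
    assume "p \<noteq> 0"
    then have "lead_coeff p \<noteq> 0"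
      by simp
    then have "degree p < m"
      using coeff_p by metis
    moreover have "m \<le> card {x. poly p x = 0}"
    proof -
      have "y ` {..<m} \<subseteq> {x. poly p x = 0}"
        using root by auto
      then have "card (y ` {..<m}) \<le> card {x. poly p x = 0}"
        using \<open>p \<noteq> 0\<close> by (intro card_mono poly_roots_finite)
      then show ?thesis
        using inj by (simp add: card_image)
    qed
    moreover have "card {x. poly p x = 0} \<le> degree p"
      using \<open>p \<noteq> 0\<close> by (rule card_poly_roots_bound)
    ultimately show False
      by simp
  qed
  then have "v $ r = 0" if "r < m" for r
    using coeff_p[of r] that by simp
  then have "v = 0\<^sub>v m"
    using v(1) by auto
  then show False
    using v(2) by simp
qed

section \<open>The divided-difference operator\<close>

text \<open>
  On the values \<open>p (y j)\<close> of a polynomial with \<open>p 0 = 0\<close>, this matrix computes the sum of the divided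
  differences of \<open>p\<close> between \<open>y i\<close> and the points \<open>0\<close> and \<open>y l\<close>, \<open>l \<noteq> i\<close>. The summand \<open>1 / y i\<close>
  comes from the point \<open>0\<close>, whose row and column have been deleted.
\<close>

definition divdiff_mat :: "nat \<Rightarrow> (nat \<Rightarrow> 'a::field) \<Rightarrow> 'a mat" where
  "divdiff_mat m y = mat m m (\<lambda>(i, j).
     if i = j then (\<Sum>l\<in>{..<m} - {i}. 1 / (y i - y l)) + 1 / y i else - 1 / (y i - y j))"

text \<open>
  The divided-difference operator in coordinates: column \<open>r\<close> lists the coefficients of the image of
  \<open>x ^ Suc r\<close>.
\<close>

definition power_sum_mat :: "nat \<Rightarrow> (nat \<Rightarrow> 'a::comm_ring_1) \<Rightarrow> 'a mat" where
  "power_sum_mat m y = mat m m (\<lambda>(s, r).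
     if s = r then of_nat (m - r) else if s < r then \<Sum>l<m. y l ^ (r - s) else 0)"

lemma det_power_sum_mat: "det (power_sum_mat m y) = fact m"
proof -
  have "det (power_sum_mat m y) = prod_list (diag_mat (power_sum_mat m y))"
    by (rule det_upper_triangular[where n = m]) (auto simp: power_sum_mat_def)
  also have "\<dots> = (\<Prod>r<m. of_nat (m - r))"
    by (simp add: prod_list_diag_prod power_sum_mat_def atLeast0LessThan)
  also have "\<dots> = fact m"
    by (simp add: fact_prod_rev atLeast0LessThan)
  finally show ?thesis .
qed

text \<open>
  The divided difference of \<open>x ^ Suc r\<close> is \<open>\<Sum>s\<le>r. y i ^ s * y l ^ (r - s)\<close>. Summed over all \<open>l\<close>, the
  powers of \<open>y l\<close> become power sums, the one for \<open>s = r\<close> being \<open>m\<close>. Leaving out \<open>l = i\<close> costs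
  \<open>(r + 1) * y i ^ r\<close>, and the point \<open>0\<close> gives back \<open>y i ^ r\<close>; this is where \<open>m - r\<close> comes from.
\<close>

lemma divdiff_mat_apply_power:
  fixes y :: "nat \<Rightarrow> 'a::field"
  assumes inj: "inj_on y {..<m}" and nz: "y i \<noteq> 0" and i: "i < m" and r: "r < m"
  shows "(\<Sum>j<m. divdiff_mat m y $$ (i, j) * y j ^ Suc r)
       = (\<Sum>s<m. y i ^ s * power_sum_mat m y $$ (s, r))"
proof -
  let ?S = "{..<m} - {i}"
  have ne: "y i \<noteq> y l" if "l \<in> ?S" for l
    using that inj i by (auto dest: inj_onD)
  have "(\<Sum>j<m. divdiff_mat m y $$ (i, j) * y j ^ Suc r)
      = ((\<Sum>l\<in>?S. 1 / (y i - y l)) + 1 / y i) * y i ^ Suc r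
        + (\<Sum>l\<in>?S. - 1 / (y i - y l) * y l ^ Suc r)"
    using i by (subst sum.remove[of _ i]) (auto simp: divdiff_mat_def intro!: sum.cong)
  also have "\<dots> = (\<Sum>l\<in>?S. (y i ^ Suc r - y l ^ Suc r) / (y i - y l)) + y i ^ r"
    using nz by (simp add: ring_distribs sum_distrib_right sum_subtractf diff_divide_distrib sum_negf)
  also have "(\<Sum>l\<in>?S. (y i ^ Suc r - y l ^ Suc r) / (y i - y l))
      = (\<Sum>l\<in>?S. \<Sum>s<Suc r. y i ^ s * y l ^ (r - s))"
    using ne by (intro sum.cong refl) (simp only: diff_power_eq_sum, simp)
  also have "\<dots> = (\<Sum>l<m. \<Sum>s<Suc r. y i ^ s * y l ^ (r - s)) - of_nat (Suc r) * y i ^ r"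
  proof -
    have "(\<Sum>s<Suc r. y i ^ s * y i ^ (r - s)) = (\<Sum>s<Suc r. y i ^ r)"
      by (intro sum.cong refl) (simp flip: power_add)
    then show ?thesis
      using i by (simp add: sum.remove[of "{..<m}" i] del: sum.lessThan_Suc)
  qed
  also have "(\<Sum>l<m. \<Sum>s<Suc r. y i ^ s * y l ^ (r - s))
      = (\<Sum>s<r. y i ^ s * (\<Sum>l<m. y l ^ (r - s))) + of_nat m * y i ^ r"
    by (subst sum.swap) (simp add: sum_distrib_left)
  also have "\<dots> - of_nat (Suc r) * y i ^ r + y i ^ r
      = (\<Sum>s<r. y i ^ s * (\<Sum>l<m. y l ^ (r - s))) + y i ^ r * of_nat (m - r)"
    using r by (simp add: of_nat_diff algebra_simps)
  also have "\<dots> = (\<Sum>s<Suc r. y i ^ s * power_sum_mat m y $$ (s, r))"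
    using r by (simp add: power_sum_mat_def)
  also have "\<dots> = (\<Sum>s<m. y i ^ s * power_sum_mat m y $$ (s, r))"
    using r by (intro sum.mono_neutral_left) (auto simp: power_sum_mat_def)
  finally show ?thesis .
qed

lemma det_divdiff_mat:
  fixes y :: "nat \<Rightarrow> 'a::field_char_0"
  assumes inj: "inj_on y {..<m}" and nz: "\<And>i. i < m \<Longrightarrow> y i \<noteq> 0"
  shows "det (divdiff_mat m y) * (\<Prod>i<m. y i) = fact m"
proof -
  let ?N = "divdiff_mat m y" and ?V = "vandermonde_mat m y" and ?U = "power_sum_mat m y"
  let ?D = "mat_diag m y"
  have carrier: "?N \<in> carrier_mat m m" "?V \<in> carrier_mat m m" "?U \<in> carrier_mat m m"
    "?D \<in> carrier_mat m m"
    by (simp_all add: divdiff_mat_def vandermonde_mat_def power_sum_mat_def)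
  have DV: "?D * ?V = mat m m (\<lambda>(i, r). y i ^ Suc r)"
    unfolding mat_diag_mult_left[OF carrier(2)]
    by (rule eq_matI) (auto simp: vandermonde_mat_def)
  have "?N * (?D * ?V) = ?V * ?U"
  proof (rule eq_matI)
    fix i r assume "i < dim_row (?V * ?U)" "r < dim_col (?V * ?U)"
    then have ir: "i < m" "r < m"
      using carrier by auto
    have "(?N * (?D * ?V)) $$ (i, r) = (\<Sum>j<m. ?N $$ (i, j) * y j ^ Suc r)"
      using ir carrier
      by (simp add: DV scalar_prod_def atLeast0LessThan)
    also have "\<dots> = (\<Sum>s<m. y i ^ s * ?U $$ (s, r))"
      using inj nz ir by (intro divdiff_mat_apply_power) auto
    also have "\<dots> = (?V * ?U) $$ (i, r)"
      using ir carrier by (simp add: scalar_prod_def atLeast0LessThan vandermonde_mat_def)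
    finally show "(?N * (?D * ?V)) $$ (i, r) = (?V * ?U) $$ (i, r)" .
  qed (use carrier in auto)
  then have "det ?N * (det ?D * det ?V) = det ?V * det ?U"
    using carrier by (metis det_mult mult_carrier_mat)
  moreover have "det ?D = (\<Prod>i<m. y i)"
    by (subst det_upper_triangular[OF _ carrier(4)])
       (auto simp: mat_diag_def prod_list_diag_prod atLeast0LessThan)
  ultimately show ?thesis
    using det_vandermonde_mat_nonzero[OF inj] by (simp add: det_power_sum_mat ac_simps)
qed

section \<open>Discriminants\<close>

text \<open>
  The left-hand side meets every unordered pair twice, as \<open>b i - b l\<close> and as \<open>b l - b i\<close>, so each of
  the \<open>m choose 2\<close> pairs contributes the negative of a square.
\<close>

lemma prod_diff_eq_sq_diff_prod:
  "(\<Prod>i<m. \<Prod>l\<in>{..<m} - {i}. b i - b l)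
     = (-1) ^ (m choose 2) * sq_diff_prod (map b [0..<m])"
proof (induction m)
  case 0
  then show ?case
    by (simp add: sq_diff_prod_def numeral_2_eq_2)
next
  case (Suc m)
  have "(\<Prod>i<Suc m. \<Prod>l\<in>{..<Suc m} - {i}. b i - b l)
      = (\<Prod>i<m. (b i - b m) * (\<Prod>l\<in>{..<m} - {i}. b i - b l)) * (\<Prod>l<m. b m - b l)"
  proof -
    have "(\<Prod>l\<in>{..<Suc m} - {i}. b i - b l) = (b i - b m) * (\<Prod>l\<in>{..<m} - {i}. b i - b l)"
      if "i < m" for i
    proof -
      have "{..<Suc m} - {i} = insert m ({..<m} - {i})"
        using that by auto
      then show ?thesis
        by simp
    qed
    moreover have "{..<Suc m} - {m} = {..<m}"
      by auto
    ultimately show ?thesis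
      by simp
  qed
  also have "\<dots> = (\<Prod>i<m. \<Prod>l\<in>{..<m} - {i}. b i - b l) * (\<Prod>i<m. - (b i - b m)\<^sup>2)"
    by (simp add: prod.distrib[symmetric] mult_ac power2_eq_square algebra_simps)
  also have "(\<Prod>i<m. - (b i - b m)\<^sup>2) = (-1) ^ m * (\<Prod>i<m. (b i - b m)\<^sup>2)"
    by (simp add: prod_uminus)
  also have "(\<Prod>i<m. \<Prod>l\<in>{..<m} - {i}. b i - b l) * ((-1) ^ m * (\<Prod>i<m. (b i - b m)\<^sup>2))
      = (-1) ^ (Suc m choose 2) * (sq_diff_prod (map b [0..<m]) * (\<Prod>i<m. (b i - b m)\<^sup>2))"
    by (simp add: Suc.IH numeral_2_eq_2 power_add mult_ac)
  also have "sq_diff_prod (map b [0..<m]) * (\<Prod>i<m. (b i - b m)\<^sup>2)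
      = sq_diff_prod (map b [0..<Suc m])"
    by (simp add: sq_diff_prod_def del: upt_Suc)
  finally show ?case .
qed

lemma discriminant_prod_linear:
  "discriminant (\<Prod>i<m. [:- b i, 1:]) = sq_diff_prod (map b [0..<m])"
proof (rule discriminant_eq)
  have "proots (\<Prod>i<m. [:- b i, 1:]) = (\<Sum>i<m. {#b i#})"
    by (subst proots_prod) auto
  also have "\<dots> = mset (map b [0..<m])"
    by (induction m) auto
  finally show "mset (map b [0..<m]) = proots (\<Prod>i<m. [:- b i, 1:])"
    by simp
qed

section \<open>The principal minors of the Jacobian matrix\<close>

lemma lessThan_Suc_eq_insert_index:
  assumes "k < Suc m"
  shows "{..<Suc m} = insert k (insert_index k ` {..<m})"
  using insert_index_image[OF assms] assms by (auto simp: atLeast0LessThan)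

text \<open>Stated for abstract monoid operations because sums and products both have to be reindexed.\<close>

lemma (in comm_monoid_set) lessThan_Suc_insert_index:
  assumes "k < Suc m"
  shows "F g ({..<Suc m} - insert_index k ` A)
       = g k \<^bold>* F (\<lambda>l. g (insert_index k l)) ({..<m} - A)"
proof -
  have "{..<Suc m} - insert_index k ` A = insert k (insert_index k ` ({..<m} - A))"
    using inj_on_image_set_diff[OF insert_index_inj_on[of k UNIV], of "{..<m}" A]
    by (auto simp: lessThan_Suc_eq_insert_index[OF assms] dest: sym[of k])
  moreover have "k \<notin> insert_index k ` ({..<m} - A)"
    by (metis imageE insert_index_exclude)
  ultimately show ?thesis
    by (simp add: reindex[OF insert_index_inj_on] o_def)
qed

lemma root_poly_div:
  assumes "k < Suc m"
  shows "root_poly (Suc m) a div [:- a k, 1:] = (\<Prod>i<m. [:- a (insert_index k i), 1:])"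
proof -
  have "root_poly (Suc m) a = [:- a k, 1:] * (\<Prod>i<m. [:- a (insert_index k i), 1:])"
    using prod.lessThan_Suc_insert_index[OF assms, where A = "{}" and g = "\<lambda>l. [:- a l, 1:]"]
    unfolding root_poly_def by (simp only: image_empty Diff_empty)
  then show ?thesis
    by (simp only: nonzero_mult_div_cancel_left pCons_eq_0_iff one_neq_zero simp_thms)
qed

text \<open>
  Skipping the index \<open>k\<close> preserves the order of the remaining ones, so ordered pairs correspond to
  ordered pairs.
\<close>

lemma sq_diff_prod_insert_index:
  assumes "k < Suc m"
  shows "sq_diff_prod (map (\<lambda>i. a (insert_index k i)) [0..<m])
       = (\<Prod>(i, j)\<in>{(i, j). i < j \<and> j < Suc m \<and> i \<noteq> k \<and> j \<noteq> k}. (a i - a j)\<^sup>2)"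
proof -
  let ?h = "insert_index k"
  have mono: "?h i < ?h j \<longleftrightarrow> i < j" for i j
    by (auto simp: insert_index_def)
  have h_eq: "?h i = ?h j \<longleftrightarrow> i = j" for i j
    using mono by (metis linorder_neq_iff)
  have "sq_diff_prod (map (\<lambda>i. a (?h i)) [0..<m])
      = (\<Prod>j<m. \<Prod>i<j. (a (?h i) - a (?h j))\<^sup>2)"
    by (simp add: sq_diff_prod_def)
  also have "\<dots> = (\<Prod>(j, i)\<in>(SIGMA j:{..<m}. {..<j}). (a (?h i) - a (?h j))\<^sup>2)"
    by (subst prod.Sigma) auto
  also have "\<dots> = (\<Prod>(i, j)\<in>{(i, j). i < j \<and> j < Suc m \<and> i \<noteq> k \<and> j \<noteq> k}. (a i - a j)\<^sup>2)"
  proof (rule prod.reindex_cong[where l = "\<lambda>(j, i). (?h i, ?h j)", symmetric])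
    show "inj_on (\<lambda>(j, i). (?h i, ?h j)) (SIGMA j:{..<m}. {..<j})"
      by (auto simp: inj_on_def h_eq)
    show "{(i, j). i < j \<and> j < Suc m \<and> i \<noteq> k \<and> j \<noteq> k}
        = (\<lambda>(j, i). (?h i, ?h j)) ` (SIGMA j:{..<m}. {..<j})" (is "?P = ?Q")
    proof (intro equalityI subsetI)
      fix p assume "p \<in> ?P"
      then obtain i j where p: "p = (i, j)" "i < j" "j < Suc m" "i \<noteq> k" "j \<noteq> k"
        by auto
      then have "i \<in> {..<Suc m}" "j \<in> {..<Suc m}"
        by auto
      with p have "i \<in> ?h ` {..<m}" "j \<in> ?h ` {..<m}"
        unfolding lessThan_Suc_eq_insert_index[OF assms] by blast+
      then obtain i' j' where "i = ?h i'" "j = ?h j'" "j' < m"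
        by auto
      then show "p \<in> ?Q"
        using p mono by (auto intro!: image_eqI[of _ _ "(j', i')"])
    next
      fix p assume "p \<in> ?Q"
      then obtain i j where p: "p = (?h i, ?h j)" "i < j" "j < m"
        by auto
      moreover have "?h j < Suc m"
        using p(3) by (simp add: insert_index_def)
      ultimately show "p \<in> ?P"
        by (simp add: mono)
    qed
  qed auto
  finally show ?thesis .
qed

text \<open>
  Distinctness of the points allows the factor \<open>f'(\<alpha>\<^sub>i)\<close> to be taken out of row \<open>i\<close>, which turns the
  polynomial entries into the partial fractions of a divided-difference operator.
\<close>

lemma jacobian_mat_index_divide:
  assumes inj: "inj_on a {..<n}" and ij: "i < n" "j < n"
  shows "jacobian_mat n a $$ (i, j) = (\<Prod>m\<in>{..<n} - {i}. a i - a m) *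
      (if i = j then \<Sum>l\<in>{..<n} - {i}. 1 / (a i - a l) else - 1 / (a i - a j))"
proof -
  have *: "(\<Prod>m\<in>{..<n} - {i, l}. a i - a m) = (\<Prod>m\<in>{..<n} - {i}. a i - a m) / (a i - a l)"
    if l: "l < n" "l \<noteq> i" for l
  proof -
    have "{..<n} - {i} - {l} = {..<n} - {i, l}"
      by auto
    then have "(\<Prod>m\<in>{..<n} - {i}. a i - a m) = (a i - a l) * (\<Prod>m\<in>{..<n} - {i, l}. a i - a m)"
      using l by (subst prod.remove[of _ l]) auto
    moreover have "a i \<noteq> a l"
      using inj ij l by (auto dest: inj_onD)
    ultimately show ?thesis
      by simp
  qed
  show ?thesis
  proof (cases "i = j")
    case True
    have "(\<Sum>l\<in>{..<n} - {i}. \<Prod>m\<in>{..<n} - {i, l}. a i - a m)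
        = (\<Sum>l\<in>{..<n} - {i}. (\<Prod>m\<in>{..<n} - {i}. a i - a m) / (a i - a l))"
      by (intro sum.cong refl *) auto
    then show ?thesis
      using ij True by (simp add: jacobian_mat_index sum_distrib_left)
  next
    case False
    then show ?thesis
      using ij *[of j] by (simp add: jacobian_mat_index)
  qed
qed

lemma mat_delete_jacobian_mat:
  assumes inj: "inj_on a {..<Suc m}" and k: "k < Suc m"
    and y_def: "y = (\<lambda>i. a (insert_index k i) - a k)"
  shows "mat_delete (jacobian_mat (Suc m) a) k k
       = mat_diag m (\<lambda>i. y i * (\<Prod>l\<in>{..<m} - {i}. y i - y l)) * divdiff_mat m y"
proof (rule eq_matI)
  let ?h = "insert_index k"
  let ?F = "\<lambda>i. y i * (\<Prod>l\<in>{..<m} - {i}. y i - y l)"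
  have carrier: "divdiff_mat m y \<in> carrier_mat m m"
    by (simp add: divdiff_mat_def)
  fix i j
  assume "i < dim_row (mat_diag m ?F * divdiff_mat m y)"
    and "j < dim_col (mat_diag m ?F * divdiff_mat m y)"
  then have ij: "i < m" "j < m"
    using carrier by (auto simp: mat_diag_def)
  have h: "?h i < Suc m" "?h j < Suc m"
    using ij by (auto simp: insert_index_def)
  have h_eq: "?h i = ?h j \<longleftrightarrow> i = j"
    using insert_index_inj_on[of k UNIV] by (auto dest: inj_onD)
  have F: "(\<Prod>l\<in>{..<Suc m} - {?h i}. a (?h i) - a l) = ?F i"
    using prod.lessThan_Suc_insert_index[OF k, where A = "{i}"] by (simp add: y_def)
  have S: "(\<Sum>l\<in>{..<Suc m} - {?h i}. 1 / (a (?h i) - a l))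
      = (\<Sum>l\<in>{..<m} - {i}. 1 / (y i - y l)) + 1 / y i"
    using sum.lessThan_Suc_insert_index[OF k, where A = "{i}" and g = "\<lambda>l. 1 / (a (?h i) - a l)"]
    by (simp add: y_def add.commute del: sum.lessThan_Suc)
  have "mat_delete (jacobian_mat (Suc m) a) k k $$ (i, j) = jacobian_mat (Suc m) a $$ (?h i, ?h j)"
    using ij by (simp add: mat_delete_def jacobian_mat_def insert_index_def)
  also have "\<dots> = ?F i * divdiff_mat m y $$ (i, j)"
  proof (cases "j = i")
    case True
    then show ?thesis
      using ij h by (simp add: jacobian_mat_index_divide[OF inj] F S divdiff_mat_def)
  next
    case False
    have "y i - y j = a (?h i) - a (?h j)"
      by (simp add: y_def)
    with False show ?thesis
      using ij h by (simp add: jacobian_mat_index_divide[OF inj] F h_eq divdiff_mat_def)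
  qed
  also have "\<dots> = (mat_diag m ?F * divdiff_mat m y) $$ (i, j)"
    using ij by (simp add: mat_diag_mult_left[OF carrier])
  finally show "mat_delete (jacobian_mat (Suc m) a) k k $$ (i, j)
      = (mat_diag m ?F * divdiff_mat m y) $$ (i, j)" .
qed (auto simp: mat_delete_def jacobian_mat_def divdiff_mat_def mat_diag_def)

lemma det_mat_delete_jacobian_mat:
  assumes inj: "inj_on a {..<Suc m}" and k: "k < Suc m"
  shows "det (mat_delete (jacobian_mat (Suc m) a) k k)
       = (-1) ^ (m choose 2) * fact m * sq_diff_prod (map (\<lambda>i. a (insert_index k i)) [0..<m])"
proof -
  let ?h = "insert_index k"
  define y where "y = (\<lambda>i. a (?h i) - a k)"
  let ?F = "\<lambda>i. y i * (\<Prod>l\<in>{..<m} - {i}. y i - y l)"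
  have carrier: "mat_diag m ?F \<in> carrier_mat m m" "divdiff_mat m y \<in> carrier_mat m m"
    by (simp_all add: divdiff_mat_def)
  have h: "?h i < Suc m" if "i < m" for i
    using that by (simp add: insert_index_def)
  have "y i \<noteq> 0" if "i < m" for i
    using inj_onD[OF inj, of "?h i" k] k h[OF that] by (auto simp: y_def)
  moreover have "inj_on y {..<m}"
  proof (rule inj_onI)
    fix i j assume "i \<in> {..<m}" "j \<in> {..<m}" "y i = y j"
    then have "?h i = ?h j"
      by (intro inj_onD[OF inj]) (auto simp: y_def h)
    then show "i = j"
      using insert_index_inj_on[of k UNIV] by (auto dest: inj_onD)
  qed
  ultimately have N: "det (divdiff_mat m y) * (\<Prod>i<m. y i) = fact m"
    by (intro det_divdiff_mat)
  have "det (mat_delete (jacobian_mat (Suc m) a) k k)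
      = det (mat_diag m ?F) * det (divdiff_mat m y)"
    using carrier by (simp add: mat_delete_jacobian_mat[OF inj k y_def] det_mult[of _ m])
  also have "det (mat_diag m ?F) = (\<Prod>i<m. y i) * (\<Prod>i<m. \<Prod>l\<in>{..<m} - {i}. y i - y l)"
    by (subst det_upper_triangular[OF _ carrier(1)])
       (auto simp: mat_diag_def prod_list_diag_prod atLeast0LessThan prod.distrib)
  also have "(\<Prod>i<m. \<Prod>l\<in>{..<m} - {i}. y i - y l)
      = (-1) ^ (m choose 2) * sq_diff_prod (map (\<lambda>i. a (?h i)) [0..<m])"
    by (subst prod_diff_eq_sq_diff_prod[symmetric]) (simp add: y_def)
  finally show ?thesis
    using N by (simp add: mult_ac)
qed

theorem mainTheorem1:
  fixes n k :: nat and \<alpha> :: "nat \<Rightarrow> complex"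
  assumes "n \<ge> 2"
    and "inj_on \<alpha> {..<n}"
    and "k < n"
  shows "det (mat_delete (jacobian_mat n \<alpha>) k k)
           = (-1) ^ ((n - 1) choose 2) * fact (n - 1)
             * discriminant (root_poly n \<alpha> div [:- \<alpha> k, 1:])
       \<and> (-1) ^ ((n - 1) choose 2) * fact (n - 1)
             * discriminant (root_poly n \<alpha> div [:- \<alpha> k, 1:])
           = (-1) ^ ((n - 1) choose 2) * fact (n - 1)
             * (\<Prod>(i, j)\<in>{(i, j). i < j \<and> j < n \<and> i \<noteq> k \<and> j \<noteq> k}. (\<alpha> i - \<alpha> j)\<^sup>2)"
proof -
  obtain m where n: "n = Suc m"
    using assms(3) by (cases n) auto
  note inj = assms(2)[unfolded n] and k = assms(3)[unfolded n]
  have "discriminant (root_poly n \<alpha> div [:- \<alpha> k, 1:])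
      = sq_diff_prod (map (\<lambda>i. \<alpha> (insert_index k i)) [0..<m])"
    by (simp only: n root_poly_div[OF k] discriminant_prod_linear)
  then show ?thesis
    using det_mat_delete_jacobian_mat[OF inj k] sq_diff_prod_insert_index[OF k, of \<alpha>]
    by (simp add: n)
qed

end
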